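(* Let $n\ge 1$ be an integer and let $T\subseteq \{1,\ldots,\lfloor n/2\rfloor\}$ be a set such that $t(n-t)$ is even for all $t\in T$. Let $\mathcal{F}_T=\{K_{t,n-t}: t\in T\}$ and let $W_T = T\cup\{n-t : t\in T\}\cup\{n\}$. Then \[ r_{odd}(n,\mathcal{F}_T) = n-\ell(n,W_T). \]
   Context: $K_n$ is the complete graph on vertex set $[n]=\{1,\ldots,n\}$, and $K_{a,b}$ is the complete bipartite graph with parts of sizes $a$ and $b$. A copy of a graph $H$ in $K_n$ is a (not necessarily induced) subgraph of $K_n$ isomorphic to $H$. For a positive integer $r$, an $r$-colouring $G_1,\ldots,G_r$ of $K_n$ is a partition of the edge set of $K_n$ into $r$ (possibly empty) colour classes. A copy of $H$ has an odd colour class if it contains an odd number of edges of $G_i$ for some $i$. For a family $\mathcal{H}$ of graphs, the odd-Ramsey number $r_{odd}(n,\mathcal{H})$ is the minimum positive integer $r$ for which there exists an $r$-colouring of $K_n$ such that every copy in $K_n$ of every graph $H\in\mathcal{H}$ has an odd colour class. A linear binary code of length $n$ is a linear subspace $\mathcal{C}\subseteq\mathbb{F}_2^n$. The weight $\mathrm{wt}(\mathbf{v})$ of $\mathbf{v}\in\mathbb{F}_2^n$ is the number of nonzero entries of $\mathbf{v}$. For $S\subseteq[n]$, \[\ell(n,S)=\max\{\dim(\mathcal{C}) : \mathcal{C}\subseteq\mathbb{F}_2^n \text{ is linear and } \mathrm{wt}(\mathbf{v})\notin S\text{ for all }\mathbf{v}\in\mathcal{C}\}.\] *)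

theory Defs
  imports Complex_Main "HOL-Library.Z2" "HOL-Library.Function_Algebras" "HOL-Library.Disjoint_Sets"
begin

text \<open>A graph is a pair consisting of a vertex set and a set of edges, an edge being a
  two-element set of vertices.\<close>

type_synonym 'v ugraph = "'v set \<times> 'v set set"

abbreviation vertices :: "'v ugraph \<Rightarrow> 'v set" where "vertices \<equiv> fst"

abbreviation edges :: "'v ugraph \<Rightarrow> 'v set set" where "edges \<equiv> snd"

definition is_ugraph :: "'v ugraph \<Rightarrow> bool" where
  "is_ugraph G \<longleftrightarrow> (\<forall>e\<in>edges G. e \<subseteq> vertices G \<and> card e = 2)"

definition is_subgraph :: "'v ugraph \<Rightarrow> 'v ugraph \<Rightarrow> bool" where
  "is_subgraph H G \<longleftrightarrow> is_ugraph H \<and> vertices H \<subseteq> vertices G \<and> edges H \<subseteq> edges G"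

definition graph_iso :: "'v ugraph \<Rightarrow> 'w ugraph \<Rightarrow> bool" where
  "graph_iso G H \<longleftrightarrow>
     (\<exists>f. bij_betw f (vertices G) (vertices H) \<and> (\<lambda>e. f ` e) ` edges G = edges H)"

definition complete_graph :: "nat \<Rightarrow> nat ugraph" where
  "complete_graph n = ({1..n}, {e. e \<subseteq> {1..n} \<and> card e = 2})"

definition complete_bipartite :: "nat \<Rightarrow> nat \<Rightarrow> (nat + nat) ugraph" where
  "complete_bipartite a b =
     ({1..a} <+> {1..b}, {{Inl i, Inr j} | i j. i \<in> {1..a} \<and> j \<in> {1..b}})"

definition is_copy :: "nat \<Rightarrow> 'v ugraph \<Rightarrow> nat ugraph \<Rightarrow> bool" where
  "is_copy n H H' \<longleftrightarrow> is_subgraph H' (complete_graph n) \<and> graph_iso H' H"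

text \<open>The colour classes are \<open>G 1, \<dots>, G r\<close>; the values of \<open>G\<close> at other indices are irrelevant.\<close>

definition is_colouring :: "nat \<Rightarrow> nat \<Rightarrow> (nat \<Rightarrow> nat set set) \<Rightarrow> bool" where
  "is_colouring n r G \<longleftrightarrow>
     disjoint_family_on G {1..r} \<and> (\<Union>i\<in>{1..r}. G i) = edges (complete_graph n)"

definition has_odd_class :: "nat \<Rightarrow> (nat \<Rightarrow> nat set set) \<Rightarrow> nat ugraph \<Rightarrow> bool" where
  "has_odd_class r G H \<longleftrightarrow> (\<exists>i\<in>{1..r}. odd (card (edges H \<inter> G i)))"

text \<open>A suitable colouring exists for some \<open>r\<close> (for instance the one giving all edges different
  colours) as soon as no member of the family is edgeless.  For other families the minimum need
  not exist, and then the value below is unspecified.\<close>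

definition r_odd :: "nat \<Rightarrow> 'v ugraph set \<Rightarrow> nat" where
  "r_odd n \<H> = (LEAST r. 1 \<le> r \<and>
     (\<exists>G. is_colouring n r G \<and> (\<forall>H\<in>\<H>. \<forall>H'. is_copy n H H' \<longrightarrow> has_odd_class r G H')))"

text \<open>The space \<open>F\<^sub>2\<^sup>n\<close> is realised inside the vector space of all functions from \<open>nat\<close> to the
  two-element field \<open>bit\<close>, as the subspace of the functions vanishing outside \<open>{1..n}\<close>.\<close>

definition scale2 :: "bit \<Rightarrow> (nat \<Rightarrow> bit) \<Rightarrow> nat \<Rightarrow> bit" where
  "scale2 c v = (\<lambda>i. c * v i)"

global_interpretation f2: vector_space scale2
  by unfold_locales
    (simp_all only: scale2_def fun_eq_iff plus_fun_def distrib_left distrib_right mult.assoc mult_1_left simp_thms)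

definition F2_space :: "nat \<Rightarrow> (nat \<Rightarrow> bit) set" where
  "F2_space n = {v. \<forall>i. i \<notin> {1..n} \<longrightarrow> v i = 0}"

definition is_linear_code :: "nat \<Rightarrow> (nat \<Rightarrow> bit) set \<Rightarrow> bool" where
  "is_linear_code n C \<longleftrightarrow> C \<subseteq> F2_space n \<and> f2.subspace C"

definition wt :: "(nat \<Rightarrow> bit) \<Rightarrow> nat" where
  "wt v = card {i. v i \<noteq> 0}"

text \<open>If \<open>0 \<in> S\<close> there is no admissible code and the value is unspecified.\<close>

definition ell :: "nat \<Rightarrow> nat set \<Rightarrow> nat" where
  "ell n S = Max {f2.dim C | C. is_linear_code n C \<and> (\<forall>v\<in>C. wt v \<notin> S)}"

end

theory Submission imports Defs begin

text \<open>Identify a vertex set with its characteristic vector \<open>v\<close> over the two-element field.  The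
  copies of \<open>K\<^bsub>t,n-t\<^esub>\<close> are the edge cuts of the \<open>v\<close> of weight \<open>t\<close>, and the parity of the number of cut
  edges in a fixed colour class is a linear functional of \<open>v\<close>.

  Given a good colouring with \<open>r\<close> colours, the vectors \<open>v\<close> on which the parities of the first
  \<open>r - 1\<close> colours vanish and whose first entry is \<open>0\<close> form a code of dimension at least \<open>n - r\<close>.
  As \<open>t (n - t)\<close> is even, the last parity then vanishes as well on vectors of weight \<open>t\<close> or
  \<open>n - t\<close>, so these weights do not occur; weight \<open>n\<close> is excluded by the first entry.

  Conversely, adjoin the all-ones vector to a code of maximal dimension and put the parity checks of
  the result in systematic form: each check expresses the entry at a position \<open>p\<close> of a set \<open>P\<close> by
  entries outside \<open>P\<close>.  The check of \<open>p\<close> has even weight, so it is the cut parity of a star centred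
  at \<open>p\<close>.  The stars have disjoint edge sets, and one more colour takes the remaining edges.\<close>

text \<open>These rules would turn field arithmetic into bit operations.\<close>

declare add_bit_eq_xor [simp del] mult_bit_eq_and [simp del]

section \<open>Arithmetic in the two-element field and subspaces over it\<close>

lemma bit_add_self [simp]: "x + x = (0::bit)"
  by (cases x) simp_all

lemma bit_add_eq_0_iff: "x + y = 0 \<longleftrightarrow> x = y" for x y :: bit
  by (cases x; cases y) simp_all

lemma of_nat_bit_eq_0_iff: "of_nat k = (0::bit) \<longleftrightarrow> even k"
  by (induction k) (auto simp: bit_add_eq_0_iff)

lemma sum_fun_apply: "(\<Sum>i\<in>I. f i) x = (\<Sum>i\<in>I. f i x)"
  by (induction I rule: infinite_finite_induct) auto

text \<open>The only scalars are 0 and 1, so closure under scaling follows from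
  \<open>0 \<in> S\<close>.\<close>

lemma f2_subspaceI:
  assumes "0 \<in> S" "\<And>x y. x \<in> S \<Longrightarrow> y \<in> S \<Longrightarrow> x + y \<in> S"
  shows "f2.subspace S"
proof (rule f2.subspaceI)
  fix c x assume "x \<in> S"
  then show "scale2 c x \<in> S"
    using assms(1) by (cases c) (simp_all only: f2.scale_zero_left f2.scale_one)
qed (use assms in auto)

section \<open>Characteristic vectors and the dimension of \<open>F2_space\<close>\<close>

definition char_vec :: "nat set \<Rightarrow> nat \<Rightarrow> bit" where
  "char_vec A = (\<lambda>x. of_bool (x \<in> A))"

lemma char_vec_apply [simp]: "char_vec A x = of_bool (x \<in> A)"
  by (simp add: char_vec_def)

lemma char_vec_in_F2_space: "A \<subseteq> {1..n} \<Longrightarrow> char_vec A \<in> F2_space n"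
  by (auto simp: F2_space_def)

lemma wt_char_vec: "wt (char_vec A) = card A"
  by (simp add: wt_def)

lemma F2_space_eq_image_char_vec: "F2_space n = char_vec ` Pow {1..n}"
proof (intro equalityI subsetI)
  fix v assume v: "v \<in> F2_space n"
  have "v = char_vec {i. v i = 1}"
    by (auto simp: fun_eq_iff)
  moreover have "{i. v i = 1} \<subseteq> {1..n}"
    using v unfolding F2_space_def by (force simp del: bit_not_zero_iff)
  ultimately show "v \<in> char_vec ` Pow {1..n}" by blast
qed (auto intro!: char_vec_in_F2_space)

lemma finite_F2_space: "finite (F2_space n)"
  by (simp add: F2_space_eq_image_char_vec)

lemma subspace_F2_space: "f2.subspace (F2_space n)"
  by (rule f2_subspaceI) (auto simp: F2_space_def)

lemma independent_units:
  assumes "finite I"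
  shows "f2.independent ((\<lambda>i. char_vec {i}) ` I)"
  using assms
proof (induction I)
  case (insert i I)
  \<comment> \<open>The other unit vectors lie in the hyperplane of vectors vanishing at
    \<open>i\<close>, which misses \<open>char_vec {i}\<close>.\<close>
  have "f2.subspace {v. v i = 0}" by (rule f2_subspaceI) auto
  then have "f2.span ((\<lambda>i. char_vec {i}) ` I) \<subseteq> {v. v i = 0}"
    using insert.hyps by (intro f2.span_minimal) auto
  then have "char_vec {i} \<notin> f2.span ((\<lambda>i. char_vec {i}) ` I)" by auto
  then show ?case
    unfolding image_insert using insert.IH by (rule f2.independent_insertI)
qed (simp add: f2.independent_empty)

lemma card_units: "card ((\<lambda>i. char_vec {i}) ` I) = card I"
proof (rule card_image, rule inj_onI)
  fix i j assume "char_vec {i} = char_vec {j}"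
  then have "char_vec {i} i = char_vec {j} i" by simp
  then show "i = j" by simp
qed

lemma F2_space_subset_span: "F2_space n \<subseteq> f2.span ((\<lambda>i. char_vec {i}) ` {1..n})"
proof
  fix v assume v: "v \<in> F2_space n"
  have "v = (\<Sum>i\<in>{1..n}. scale2 (v i) (char_vec {i}))"
  proof
    fix x
    have "(\<Sum>i\<in>{1..n}. scale2 (v i) (char_vec {i})) x = (\<Sum>i\<in>{1..n}. if x = i then v i else 0)"
      unfolding sum_fun_apply by (rule sum.cong) (auto simp: scale2_def)
    also have "\<dots> = v x" using v by (auto simp: F2_space_def)
    finally show "v x = (\<Sum>i\<in>{1..n}. scale2 (v i) (char_vec {i})) x" ..
  qed
  moreover have "(\<Sum>i\<in>{1..n}. scale2 (v i) (char_vec {i})) \<in> f2.span ((\<lambda>i. char_vec {i}) ` {1..n})"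
    by (intro f2.span_sum f2.span_scale f2.span_base) auto
  ultimately show "v \<in> f2.span ((\<lambda>i. char_vec {i}) ` {1..n})" by simp
qed

lemma dim_F2_space: "f2.dim (F2_space n) = n"
  using independent_units[of "{1..n}"] card_units[of "{1..n}"]
  by (intro f2.dim_unique[OF _ F2_space_subset_span]) (auto intro!: char_vec_in_F2_space)

lemma dim_le_n: "C \<subseteq> F2_space n \<Longrightarrow> f2.dim C \<le> n"
  using f2.dim_le_card[of C "(\<lambda>i. char_vec {i}) ` {1..n}"] F2_space_subset_span[of n]
    card_units[of "{1..n}"] by auto

section \<open>Dimension lost by imposing parity conditions\<close>

text \<open>Over the two-element field an additive \<open>f\<close> is a linear functional. Two
  vectors outside its kernel have their sum in the kernel, so a basis of the kernel and one vector
  \<open>u\<close> outside it span \<open>V\<close>.\<close>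

lemma dim_le_Suc_dim_kernel:
  assumes V: "f2.subspace V" "V \<subseteq> F2_space n" and add: "\<And>x y. f (x + y) = f x + (f y :: bit)"
  shows "f2.dim V \<le> Suc (f2.dim {v \<in> V. f v = 0})"
proof -
  obtain B where B: "B \<subseteq> {v \<in> V. f v = 0}" "{v \<in> V. f v = 0} \<subseteq> f2.span B"
      "card B = f2.dim {v \<in> V. f v = 0}"
    by (rule f2.basis_exists)
  have fin: "finite B"
    by (rule finite_subset[OF _ finite_F2_space]) (use B(1) V(2) in blast)
  have "\<exists>u. V \<subseteq> f2.span (insert u B)"
  proof (cases "\<exists>u\<in>V. f u = 1")
    case True
    then obtain u where u: "u \<in> V" "f u = 1" by blast
    have "x \<in> f2.span (insert u B)" if "x \<in> V" for x
    proof (cases "f x = 0")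
      case True
      then show ?thesis using B(2) that f2.span_mono[of B "insert u B"] by blast
    next
      case False
      then have "f (x + u) = 0" using u by (simp add: add)
      then have "x + u \<in> f2.span B" using u that B(2) f2.subspace_add[OF V(1)] by blast
      then have "x + u \<in> f2.span (insert u B)"
        using f2.span_mono[OF subset_insertI] by blast
      then have "x + u + u \<in> f2.span (insert u B)"
        by (rule f2.span_add) (simp add: f2.span_base)
      moreover have "x + u + u = x" by (simp add: fun_eq_iff add.assoc)
      ultimately show ?thesis by simp
    qed
    then show ?thesis by blast
  next
    case False
    \<comment> \<open>Here \<open>f\<close> vanishes on all of \<open>V\<close>, and the zero vector
      is a placeholder for \<open>u\<close>.\<close>
    then have "V \<subseteq> f2.span (insert 0 B)" using B(2) by auto
    then show ?thesis by blast
  qed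
  then obtain u where "V \<subseteq> f2.span (insert u B)" by blast
  then have "f2.dim V \<le> card (insert u B)" using fin by (intro f2.dim_le_card) auto
  also have "\<dots> \<le> Suc (card B)" using fin by (simp add: card_insert_if)
  finally show ?thesis using B by simp
qed

lemma subspace_kernels:
  assumes "f2.subspace V" and "\<And>i x y. i \<in> I \<Longrightarrow> f i (x + y) = f i x + (f i y :: bit)"
  shows "f2.subspace {v \<in> V. \<forall>i\<in>I. f i v = 0}"
proof (rule f2_subspaceI)
  have "f i 0 = 0" if "i \<in> I" for i
    using assms(2)[OF that, of 0 0] by simp
  then show "0 \<in> {v \<in> V. \<forall>i\<in>I. f i v = 0}"
    using assms(1) f2.subspace_0 by auto
  fix x y assume "x \<in> {v \<in> V. \<forall>i\<in>I. f i v = 0}" "y \<in> {v \<in> V. \<forall>i\<in>I. f i v = 0}"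
  then show "x + y \<in> {v \<in> V. \<forall>i\<in>I. f i v = 0}"
    using f2.subspace_add[OF assms(1)] by (simp del: plus_fun_apply add: assms(2))
qed

text \<open>Imposed one after another, the conditions each cost at most one dimension.\<close>

lemma dim_le_dim_kernels:
  assumes "finite I" and V: "f2.subspace V" "V \<subseteq> F2_space n"
    and "\<And>i x y. i \<in> I \<Longrightarrow> f i (x + y) = f i x + (f i y :: bit)"
  shows "f2.dim V \<le> f2.dim {v \<in> V. \<forall>i\<in>I. f i v = 0} + card I"
  using assms(1,4)
proof (induction I)
  case (insert j I)
  let ?K = "{v \<in> V. \<forall>i\<in>I. f i v = 0}"
  have "f2.dim ?K \<le> Suc (f2.dim {v \<in> ?K. f j v = 0})"
  proof (intro dim_le_Suc_dim_kernel subspace_kernels)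
    show "?K \<subseteq> F2_space n" using V(2) by auto
  qed (use V insert.prems in blast)+
  moreover have "{v \<in> ?K. f j v = 0} = {v \<in> V. \<forall>i\<in>insert j I. f i v = 0}" by auto
  moreover have "f2.dim V \<le> f2.dim ?K + card I"
    using insert.IH insert.prems by blast
  ultimately show ?case using insert.hyps by simp
qed simp

section \<open>Edge cuts and their parities\<close>

text \<open>The endpoints of an edge have different entries in \<open>v\<close> exactly when these
  add up to 1. The sum is used because it is additive in \<open>v\<close>.\<close>

definition cut_edges :: "nat \<Rightarrow> (nat \<Rightarrow> bit) \<Rightarrow> nat set set" where
  "cut_edges n v = {e \<in> edges (complete_graph n). sum v e = 1}"

lemma cut_edges_char_vec:
  assumes "A \<subseteq> {1..n}"
  shows "cut_edges n (char_vec A) = {{a, b} | a b. a \<in> A \<and> b \<in> {1..n} - A}"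
proof (intro equalityI subsetI)
  fix e assume "e \<in> cut_edges n (char_vec A)"
  then obtain x y where e: "e = {x, y}" "x \<noteq> y" "x \<in> {1..n}" "y \<in> {1..n}" and s: "sum (char_vec A) e = 1"
    by (auto simp: cut_edges_def complete_graph_def card_2_iff)
  have "(x \<in> A) \<noteq> (y \<in> A)" using s e by auto
  then show "e \<in> {{a, b} | a b. a \<in> A \<and> b \<in> {1..n} - A}"
    using e by (auto simp: insert_commute)
next
  fix e assume "e \<in> {{a, b} | a b. a \<in> A \<and> b \<in> {1..n} - A}"
  then obtain a b where e: "e = {a, b}" and ab: "a \<in> A" "b \<in> {1..n} - A" by blast
  then have "a \<noteq> b" by blast
  then have "{a, b} \<subseteq> {1..n}" "card {a, b} = 2" "sum (char_vec A) {a, b} = 1"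
    using assms ab by auto
  then show "e \<in> cut_edges n (char_vec A)" by (simp add: e cut_edges_def complete_graph_def)
qed

lemma card_cut_char_vec:
  assumes "A \<subseteq> {1..n}"
  shows "card (cut_edges n (char_vec A)) = card A * (n - card A)"
proof -
  have "cut_edges n (char_vec A) = (\<lambda>(a, b). {a, b}) ` (A \<times> ({1..n} - A))"
    unfolding cut_edges_char_vec[OF assms] image_def Bex_def split_paired_Ex prod.case mem_Sigma_iff
    by blast
  \<comment> \<open>An edge determines which of its endpoints lies in \<open>A\<close>.\<close>
  moreover have "inj_on (\<lambda>(a, b). {a, b}) (A \<times> ({1..n} - A))"
    by (auto simp: inj_on_def doubleton_eq_iff)
  ultimately show ?thesis
    using assms by (simp add: card_image card_cartesian_product card_Diff_subset finite_subset)
qed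

text \<open>The left-hand side is additive in \<open>v\<close>; so the parity of the cut inside
  \<open>G\<close> is a linear functional, to which the dimension bounds apply.\<close>

lemma sum_cut_eq_card:
  assumes "G \<subseteq> edges (complete_graph n)"
  shows "(\<Sum>e\<in>G. sum v e) = of_nat (card (cut_edges n v \<inter> G))"
proof -
  have fin: "finite G"
    using assms by (rule finite_subset) (auto simp: complete_graph_def)
  have "(\<Sum>e\<in>G. sum v e) = (\<Sum>e\<in>G. if e \<in> cut_edges n v then 1 else 0)"
    using assms by (intro sum.cong) (auto simp: cut_edges_def simp flip: bit_not_one_iff)
  also have "\<dots> = of_nat (card (cut_edges n v \<inter> G))"
    using fin by (simp add: sum.If_cases Int_commute)
  finally show ?thesis .
qed

section \<open>Copies of complete bipartite graphs are cuts\<close>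

text \<open>\<open>A\<close> is the preimage of the left part under an isomorphism.\<close>

lemma is_copy_complete_bipartite_imp:
  assumes "t \<le> n" and H: "is_copy n (complete_bipartite t (n - t)) H"
  shows "\<exists>A \<subseteq> {1..n}. card A = t \<and> H = ({1..n}, cut_edges n (char_vec A))"
proof -
  obtain V E where VE: "H = (V, E)" by (cases H)
  let ?K = "complete_bipartite t (n - t)"
  obtain f where f: "bij_betw f V ({1..t} <+> {1..n - t})" and fE: "(\<lambda>e. f ` e) ` E = edges ?K"
    using H by (auto simp: is_copy_def graph_iso_def VE complete_bipartite_def)
  have sub: "V \<subseteq> {1..n}" "\<And>e. e \<in> E \<Longrightarrow> e \<subseteq> V"
    using H by (auto simp: is_copy_def is_subgraph_def is_ugraph_def complete_graph_def VE)
  \<comment> \<open>The copy is spanning, so the preimage of the right part is all of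
    \<open>{1..n} - A\<close>.\<close>
  have "card V = n"
    using bij_betw_same_card[OF f] assms(1) by (simp add: card_Plus)
  then have V: "V = {1..n}" using sub(1) by (intro card_subset_eq) auto
  have inj: "inj_on f {1..n}" and img: "f ` {1..n} = {1..t} <+> {1..n - t}"
    using f by (auto simp: bij_betw_def V)
  define A where "A = {x \<in> {1..n}. f x \<in> Inl ` {1..t}}"
  have A: "A \<subseteq> {1..n}" by (auto simp: A_def)
  have "f ` A = Inl ` {1..t}"
  proof (intro equalityI subsetI)
    fix y :: "nat + nat" assume y: "y \<in> Inl ` {1..t}"
    then have "y \<in> f ` {1..n}" unfolding img by auto
    then show "y \<in> f ` A" using y by (auto simp: A_def)
  qed (auto simp: A_def)
  moreover have "inj_on f A" using inj A inj_on_subset by blast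
  ultimately have cA: "card A = t"
    using card_image[of f A] card_image[of "Inl :: nat \<Rightarrow> nat + nat" "{1..t}"] by simp
  have notA: "f x \<in> Inr ` {1..n - t}" if "x \<in> {1..n} - A" for x
  proof -
    have "f x \<in> {1..t} <+> {1..n - t}" using that img by blast
    then show ?thesis using that by (auto simp: A_def)
  qed
  \<comment> \<open>Edges can be compared through their images under \<open>f\<close>.\<close>
  have eq: "e = e'" if "e \<subseteq> {1..n}" "e' \<subseteq> {1..n}" "f ` e = f ` e'" for e e'
    using inj_on_image_eq_iff[OF inj that(1,2)] that(3) by simp
  have "E = cut_edges n (char_vec A)"
    unfolding cut_edges_char_vec[OF A]
  proof (intro equalityI subsetI)
    fix e assume e: "e \<in> E"
    then have "f ` e \<in> edges ?K" using fE by blast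
    then obtain i j where ij: "f ` e = {Inl i, Inr j}" "i \<in> {1..t}" "j \<in> {1..n - t}"
      by (auto simp: complete_bipartite_def)
    then have "Inl i \<in> f ` {1..n}" "Inr j \<in> f ` {1..n}" unfolding img by auto
    then obtain a b where ab: "a \<in> {1..n}" "f a = Inl i" "b \<in> {1..n}" "f b = Inr j"
      by (metis imageE)
    have "e = {a, b}"
      using e sub(2) V ab ij by (intro eq) auto
    moreover have "a \<in> A" "b \<in> {1..n} - A" using ab ij by (auto simp: A_def)
    ultimately show "e \<in> {{a, b} | a b. a \<in> A \<and> b \<in> {1..n} - A}" by blast
  next
    fix e assume "e \<in> {{a, b} | a b. a \<in> A \<and> b \<in> {1..n} - A}"
    then obtain a b where ab: "e = {a, b}" "a \<in> A" "b \<in> {1..n} - A" by blast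
    have "f a \<in> Inl ` {1..t}" "f b \<in> Inr ` {1..n - t}"
      using ab notA by (auto simp: A_def)
    then have "f ` e \<in> edges ?K"
      unfolding complete_bipartite_def ab(1) by fastforce
    then obtain e' where e': "e' \<in> E" "f ` e = f ` e'" using fE by (metis imageE)
    then have "e = e'" using ab A sub(2) V by (intro eq) auto
    with e' show "e \<in> E" by simp
  qed
  then show ?thesis unfolding VE V using cA A by blast
qed

text \<open>The isomorphism is glued from arbitrary bijections of \<open>A\<close> and of its
  complement onto the two parts.\<close>

lemma is_copy_complete_bipartite_cut:
  assumes A: "A \<subseteq> {1..n}"
  shows "is_copy n (complete_bipartite (card A) (n - card A)) ({1..n}, cut_edges n (char_vec A))"
proof -
  let ?t = "card A" and ?B = "{1..n} - A"
  have "finite A" using A finite_subset by blast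
  then obtain g where g: "bij_betw g A {1..?t}"
    using finite_same_card_bij[of A "{1..?t}"] by auto
  have "card ?B = n - ?t" using A by (simp add: card_Diff_subset finite_subset)
  then obtain h where h: "bij_betw h ?B {1..n - ?t}"
    using finite_same_card_bij[of ?B "{1..n - ?t}"] by auto
  define f :: "nat \<Rightarrow> nat + nat" where "f x = (if x \<in> A then Inl (g x) else Inr (h x))" for x
  have "bij_betw f A (Inl ` {1..?t})"
    using g by (auto simp: bij_betw_def inj_on_def f_def image_iff)
  moreover have "bij_betw f ?B (Inr ` {1..n - ?t})"
    using h by (auto simp: bij_betw_def inj_on_def f_def image_iff)
  ultimately have "bij_betw f (A \<union> ?B) (Inl ` {1..?t} \<union> Inr ` {1..n - ?t})"
    by (rule bij_betw_combine) auto
  moreover have "A \<union> ?B = {1..n}" using A by auto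
  ultimately have f: "bij_betw f {1..n} ({1..?t} <+> {1..n - ?t})"
    by (simp add: Plus_def)
  have gi: "g ` A = {1..?t}" and hi: "h ` ?B = {1..n - ?t}"
    using g h by (auto simp: bij_betw_def)
  have "(\<lambda>e. f ` e) ` cut_edges n (char_vec A) = edges (complete_bipartite ?t (n - ?t))"
  proof (intro equalityI subsetI)
    fix e assume "e \<in> (\<lambda>e. f ` e) ` cut_edges n (char_vec A)"
    then obtain a b where ab: "e = f ` {a, b}" "a \<in> A" "b \<in> ?B"
      unfolding cut_edges_char_vec[OF A] by blast
    then have "e = {Inl (g a), Inr (h b)}" by (auto simp: f_def)
    moreover have "g a \<in> {1..?t}" "h b \<in> {1..n - ?t}" using ab gi hi by blast+
    ultimately show "e \<in> edges (complete_bipartite ?t (n - ?t))"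
      unfolding complete_bipartite_def by auto
  next
    fix e assume "e \<in> edges (complete_bipartite ?t (n - ?t))"
    then obtain i j where ij: "e = {Inl i, Inr j}" "i \<in> {1..?t}" "j \<in> {1..n - ?t}"
      by (auto simp: complete_bipartite_def)
    then obtain a b where ab: "a \<in> A" "b \<in> ?B" "g a = i" "h b = j"
      by (metis gi hi imageE)
    then have "e = f ` {a, b}" using ij by (auto simp: f_def)
    then show "e \<in> (\<lambda>e. f ` e) ` cut_edges n (char_vec A)"
      unfolding cut_edges_char_vec[OF A] using ab by blast
  qed
  then show ?thesis using f
    by (auto simp: is_copy_def graph_iso_def is_subgraph_def is_ugraph_def complete_graph_def
        complete_bipartite_def cut_edges_def)
qed

section \<open>From a code to a colouring by stars\<close>

text \<open>\<open>P\<close> is a maximal set of positions that supports no nonzero word of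
  \<open>D\<close>. Adding a position \<open>q\<close> therefore admits a nonzero word, which has
  entry 1 at \<open>q\<close> and 0 elsewhere outside \<open>P\<close>; this is \<open>c q\<close>.
  The complement of \<open>P\<close> is an information set, and the \<open>c q\<close> are the rows
  of a systematic generator matrix.\<close>

lemma exists_information_set:
  assumes D: "f2.subspace D" "D \<subseteq> F2_space n"
  obtains P c where "P \<subseteq> {1..n}" "card P + f2.dim D \<le> n"
    "\<And>v. v \<in> D \<Longrightarrow> \<forall>i. i \<notin> P \<longrightarrow> v i = 0 \<Longrightarrow> v = 0"
    "\<And>q. q \<in> {1..n} - P \<Longrightarrow> c q \<in> D"
    "\<And>q i. q \<in> {1..n} - P \<Longrightarrow> i \<notin> P \<Longrightarrow> c q i = of_bool (i = q)"
proof -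
  define U where "U P \<longleftrightarrow> P \<subseteq> {1..n} \<and> (\<forall>v\<in>D. (\<forall>i. i \<notin> P \<longrightarrow> v i = 0) \<longrightarrow> v = 0)" for P
  have "finite {P. U P}"
    by (rule finite_subset[of _ "Pow {1..n}"]) (auto simp: U_def)
  moreover have "U {}" by (auto simp: U_def fun_eq_iff)
  then have "{P. U P} \<noteq> {}" by blast
  ultimately have "\<exists>P\<in>{P. U P}. \<forall>P'\<in>{P. U P}. P \<le> P' \<longrightarrow> P = P'"
    by (rule finite_has_maximal)
  then obtain P where P: "U P" and max: "\<And>P'. U P' \<Longrightarrow> P \<subseteq> P' \<Longrightarrow> P = P'" by blast
  have sub: "P \<subseteq> {1..n}" and zero: "\<And>v. v \<in> D \<Longrightarrow> \<forall>i. i \<notin> P \<longrightarrow> v i = 0 \<Longrightarrow> v = 0"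
    using P by (auto simp: U_def)
  have "\<exists>w. w \<in> D \<and> (\<forall>i. i \<notin> P \<longrightarrow> w i = of_bool (i = q))" if q: "q \<in> {1..n} - P" for q
  proof -
    have "\<not> U (insert q P)" using max[of "insert q P"] q by blast
    then obtain w where w: "w \<in> D" "\<forall>i. i \<notin> insert q P \<longrightarrow> w i = 0" "w \<noteq> 0"
      using q sub by (auto simp: U_def)
    have "w q = 1"
    proof (rule ccontr)
      assume "w q \<noteq> 1"
      then have "\<forall>i. i \<notin> P \<longrightarrow> w i = 0" using w(2) by auto
      then show False using zero w by blast
    qed
    then have "\<forall>i. i \<notin> P \<longrightarrow> w i = of_bool (i = q)" using w(2) by auto
    with w(1) show ?thesis by blast
  qed
  then obtain c where c: "\<And>q. q \<in> {1..n} - P \<Longrightarrow> c q \<in> D \<and> (\<forall>i. i \<notin> P \<longrightarrow> c q i = of_bool (i = q))"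
    by metis
  let ?I = "{1..n} - P"
  \<comment> \<open>The entries at \<open>?I\<close> determine a word of \<open>D\<close>, so the
    evaluations there have trivial common kernel and \<open>D\<close> has dimension at most
    \<open>card ?I\<close>.\<close>
  have "v = 0" if "v \<in> D" "\<forall>i\<in>?I. v i = 0" for v
  proof (rule zero[OF that(1)], intro allI impI)
    fix i assume "i \<notin> P"
    then show "v i = 0" using that D(2) by (cases "i \<in> {1..n}") (auto simp: F2_space_def)
  qed
  then have "{v \<in> D. \<forall>i\<in>?I. v i = 0} \<subseteq> f2.span {}" by auto
  then have "f2.dim {v \<in> D. \<forall>i\<in>?I. v i = 0} \<le> card ({} :: (nat \<Rightarrow> bit) set)"
    by (rule f2.dim_le_card) simp
  moreover have "f2.dim D \<le> f2.dim {v \<in> D. \<forall>i\<in>?I. v i = 0} + card ?I"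
    by (rule dim_le_dim_kernels[OF _ D, of ?I "\<lambda>i v. v i"]) simp_all
  ultimately have "f2.dim D \<le> card ?I" by simp
  also have "\<dots> = n - card P" using sub by (simp add: card_Diff_subset finite_subset)
  finally have "f2.dim D \<le> n - card P" .
  moreover have "card P \<le> n" using card_mono[OF _ sub] by simp
  ultimately show thesis using that[of P c] sub zero c by auto
qed

text \<open>The edges form a star with centre \<open>p\<close> whose leaves in \<open>Q\<close> are
  selected by \<open>a\<close>; the entry of the centre enters once per leaf.\<close>

lemma sum_star:
  assumes "finite Q" "p \<notin> Q"
  shows "(\<Sum>e\<in>(\<lambda>q. {p, q}) ` {q \<in> Q. a q = 1}. sum v e) = (\<Sum>q\<in>Q. a q * (v p + (v q :: bit)))"
proof -
  have "(\<Sum>e\<in>(\<lambda>q. {p, q}) ` {q \<in> Q. a q = 1}. sum v e) = (\<Sum>q\<in>{q \<in> Q. a q = 1}. sum v {p, q})"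
    by (subst sum.reindex) (auto simp: inj_on_def doubleton_eq_iff)
  also have "\<dots> = (\<Sum>q\<in>{q \<in> Q. a q = 1}. v p + v q)"
  proof (rule sum.cong[OF refl])
    fix q assume "q \<in> {q \<in> Q. a q = 1}"
    then have "p \<noteq> q" using assms(2) by blast
    then show "sum v {p, q} = v p + v q" by simp
  qed
  also have "\<dots> = (\<Sum>q\<in>Q. if a q = 1 then v p + v q else 0)"
    using assms(1) by (rule sum.inter_filter)
  also have "\<dots> = (\<Sum>q\<in>Q. a q * (v p + v q))"
  proof (rule sum.cong[OF refl])
    fix q
    show "(if a q = 1 then v p + v q else 0) = a q * (v p + v q)"
      by (cases "a q = 0") auto
  qed
  finally show ?thesis .
qed

text \<open>The star at \<open>p\<close> has as leaves the \<open>q\<close> with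
  \<open>c q p = 1\<close>. Their number is odd because the all-ones vector is in \<open>D\<close>,
  so \<open>v p\<close> survives in the cut parity, which becomes the parity check expressing
  \<open>v p\<close> by entries outside \<open>P\<close>. If all checks hold, \<open>v\<close> is
  the combination of the \<open>c q\<close> with coefficients \<open>v q\<close>.\<close>

lemma exists_star_colouring:
  assumes D: "f2.subspace D" "D \<subseteq> F2_space n" and one: "char_vec {1..n} \<in> D"
  obtains r G where "1 \<le> r" "r + f2.dim D \<le> Suc n" "is_colouring n r G"
    "\<And>v. v \<in> F2_space n \<Longrightarrow> \<forall>i\<in>{1..r}. even (card (cut_edges n v \<inter> G i)) \<Longrightarrow> v \<in> D"
proof -
  obtain P c where P: "P \<subseteq> {1..n}" "card P + f2.dim D \<le> n"
    and zero: "\<And>v. v \<in> D \<Longrightarrow> \<forall>i. i \<notin> P \<longrightarrow> v i = 0 \<Longrightarrow> v = 0"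
    and cD: "\<And>q. q \<in> {1..n} - P \<Longrightarrow> c q \<in> D"
    and c: "\<And>q i. q \<in> {1..n} - P \<Longrightarrow> i \<notin> P \<Longrightarrow> c q i = of_bool (i = q)"
    using exists_information_set[OF D] by metis
  define Q where "Q = {1..n} - P"
  have Q: "finite Q" "Q \<subseteq> {1..n}" "Q \<inter> P = {}" by (auto simp: Q_def)
  have delta: "(\<Sum>q\<in>Q. a q * c q i) = (if i \<in> Q then a i else 0)" if "i \<notin> P" for a i
  proof -
    have "(\<Sum>q\<in>Q. a q * c q i) = (\<Sum>q\<in>Q. if i = q then a q else 0)"
      using c[OF _ that] by (intro sum.cong) (auto simp: Q_def)
    then show ?thesis using Q(1) by simp
  qed
  \<comment> \<open>The all-ones vector and the sum of the \<open>c q\<close> agree outside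
    \<open>P\<close>; both are in \<open>D\<close>, hence they are equal.\<close>
  have csum: "(\<Sum>q\<in>Q. c q p) = 1" if p: "p \<in> P" for p
  proof -
    have "char_vec {1..n} + (\<Sum>q\<in>Q. c q) \<in> D"
      using cD by (intro f2.subspace_add f2.subspace_sum D one) (auto simp: Q_def)
    moreover have "(char_vec {1..n} + (\<Sum>q\<in>Q. c q)) i = 0" if i: "i \<notin> P" for i
      using delta[OF i, of "\<lambda>_. 1"] i by (auto simp: sum_fun_apply Q_def)
    ultimately have "char_vec {1..n} + (\<Sum>q\<in>Q. c q) = 0" using zero by blast
    then have "(char_vec {1..n} + (\<Sum>q\<in>Q. c q)) p = 0" by simp
    then show ?thesis using p P(1) by (auto simp: sum_fun_apply bit_add_eq_0_iff)
  qed
  define S where "S p = (\<lambda>q. {p, q}) ` {q \<in> Q. c q p = 1}" for p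
  let ?E = "edges (complete_graph n)"
  have SE: "S p \<subseteq> ?E" if "p \<in> P" for p
  proof
    fix e assume "e \<in> S p"
    then obtain q where q: "e = {p, q}" "q \<in> Q" by (auto simp: S_def)
    then have "p \<noteq> q" using that Q by blast
    then show "e \<in> ?E" using q that P Q by (auto simp: complete_graph_def)
  qed
  \<comment> \<open>Leaves are outside \<open>P\<close>, so the centre is the only vertex of an edge
    in \<open>P\<close>.\<close>
  have Sdisj: "S x \<inter> S y = {}" if "x \<in> P" "y \<in> P" "x \<noteq> y" for x y
    using that Q(3) by (auto simp: S_def doubleton_eq_iff)
  obtain f where f: "bij_betw f {1..card P} P"
    using ex_bij_betw_nat_finite_1[OF finite_subset[OF P(1)]] by auto
  define m where "m = card P"
  have fP: "f i \<in> P" if "i \<in> {1..m}" for i using f that by (auto simp: bij_betw_def m_def)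
  have finj: "f i \<noteq> f j" if "i \<in> {1..m}" "j \<in> {1..m}" "i \<noteq> j" for i j
    using inj_onD[OF bij_betw_imp_inj_on[OF f]] that unfolding m_def by blast
  \<comment> \<open>Colour \<open>Suc m\<close> takes the remaining edges; it also keeps the number
    of colours positive when \<open>P\<close> is empty.\<close>
  define G where "G i = (if i \<in> {1..m} then S (f i) else ?E - (\<Union>p\<in>P. S p))" for i
  have "is_colouring n (Suc m) G"
    unfolding is_colouring_def
  proof
    show "disjoint_family_on G {1..Suc m}"
      unfolding disjoint_family_on_def
    proof (intro ballI impI)
      fix i j assume ij: "i \<in> {1..Suc m}" "j \<in> {1..Suc m}" "i \<noteq> j"
      then consider "i \<in> {1..m}" "j \<in> {1..m}" | "i \<in> {1..m}" "j = Suc m" | "i = Suc m" "j \<in> {1..m}"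
        by fastforce
      then show "G i \<inter> G j = {}"
      proof cases
        case 1
        then show ?thesis using Sdisj fP finj[OF 1 ij(3)] by (simp add: G_def)
      qed (use fP in \<open>auto simp: G_def\<close>)
    qed
    have "(\<Union>i\<in>{1..m}. G i) = (\<Union>p\<in>f ` {1..m}. S p)" by (auto simp: G_def)
    also have "f ` {1..m} = P" using f by (simp add: bij_betw_def m_def)
    finally have "(\<Union>i\<in>{1..m}. G i) = (\<Union>p\<in>P. S p)" .
    moreover have "{1..Suc m} = insert (Suc m) {1..m}" by auto
    moreover have "G (Suc m) = ?E - (\<Union>p\<in>P. S p)" by (simp add: G_def)
    ultimately show "(\<Union>i\<in>{1..Suc m}. G i) = ?E"
      using UN_least[of P S, OF SE] by auto
  qed
  moreover have "v \<in> D" if v: "v \<in> F2_space n"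
    and even: "\<forall>i\<in>{1..Suc m}. even (card (cut_edges n v \<inter> G i))" for v
  proof -
    have vp: "v p = (\<Sum>q\<in>Q. v q * c q p)" if p: "p \<in> P" for p
    proof -
      have "p \<in> f ` {1..m}" using bij_betw_imp_surj_on[OF f] p by (simp add: m_def)
      then obtain i where i: "i \<in> {1..m}" "p = f i" by (rule imageE)
      then have "G i = S p" "i \<in> {1..Suc m}" by (simp_all add: G_def)
      then have "even (card (cut_edges n v \<inter> S p))" using even by metis
      then have "0 = (\<Sum>e\<in>S p. sum v e)"
        using sum_cut_eq_card[OF SE[OF p]] by (simp add: of_nat_bit_eq_0_iff)
      also have "\<dots> = (\<Sum>q\<in>Q. c q p * (v p + v q))"
        unfolding S_def using Q p by (intro sum_star) auto
      also have "\<dots> = (\<Sum>q\<in>Q. c q p) * v p + (\<Sum>q\<in>Q. v q * c q p)"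
        unfolding distrib_left sum.distrib sum_distrib_right by (simp add: mult.commute)
      finally show ?thesis using csum[OF p] by (simp add: bit_add_eq_0_iff eq_commute[of 0])
    qed
    have "v i = (\<Sum>q\<in>Q. scale2 (v q) (c q)) i" for i
    proof (cases "i \<in> P")
      case True
      then show ?thesis by (simp add: sum_fun_apply scale2_def vp[OF True])
    next
      case False
      then show ?thesis using v delta[OF False, of v]
        by (auto simp: sum_fun_apply scale2_def Q_def F2_space_def)
    qed
    then have "v = (\<Sum>q\<in>Q. scale2 (v q) (c q))" by blast
    moreover have "(\<Sum>q\<in>Q. scale2 (v q) (c q)) \<in> D"
      using cD by (intro f2.subspace_sum f2.subspace_scale D) (auto simp: Q_def)
    ultimately show ?thesis by simp
  qed
  ultimately show thesis using that[of "Suc m" G] P(2) by (auto simp: m_def)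
qed

section \<open>The maximum in \<open>ell\<close>\<close>

lemma finite_code_dims:
  "finite {f2.dim C | C. is_linear_code n C \<and> (\<forall>v\<in>C. wt v \<notin> W)}"
  by (rule finite_subset[of _ "{..n}"]) (auto simp: is_linear_code_def dim_le_n)

lemma dim_le_ell:
  assumes "is_linear_code n C" "\<forall>v\<in>C. wt v \<notin> W"
  shows "f2.dim C \<le> ell n W"
  unfolding ell_def using assms by (intro Max_ge finite_code_dims) blast

text \<open>With \<open>0 \<notin> W\<close> the zero code is admissible, so the maximum ranges over
  a nonempty set.\<close>

lemma ell_attained:
  assumes "0 \<notin> W"
  obtains C where "is_linear_code n C" "\<forall>v\<in>C. wt v \<notin> W" "f2.dim C = ell n W"
proof -
  have "is_linear_code n {0}" "\<forall>v\<in>{0}. wt v \<notin> W"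
    using assms by (auto simp: is_linear_code_def F2_space_def wt_def)
  then have "{f2.dim C | C. is_linear_code n C \<and> (\<forall>v\<in>C. wt v \<notin> W)} \<noteq> {}" by blast
  from Max_in[OF finite_code_dims this] show thesis
    using that unfolding ell_def by auto
qed

section \<open>The two inequalities\<close>

lemma cut_edges_char_vec_compl:
  assumes "A \<subseteq> {1..n}"
  shows "cut_edges n (char_vec ({1..n} - A)) = cut_edges n (char_vec A)"
proof -
  have "{1..n} - ({1..n} - A) = A" using assms by blast
  then show ?thesis
    unfolding cut_edges_char_vec[OF assms] cut_edges_char_vec[OF Diff_subset] by (metis (lifting) insert_commute)
qed

lemma F2_spaceE:
  assumes "v \<in> F2_space n"
  obtains A where "A \<subseteq> {1..n}" "v = char_vec A"
  using assms by (auto simp: F2_space_eq_image_char_vec)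

lemma le_ell_plus_colours:
  assumes n: "1 \<le> n" and T: "T \<subseteq> {1..n div 2}" and even: "\<forall>t\<in>T. even (t * (n - t))"
    and r: "1 \<le> r" and col: "is_colouring n r G"
    and odd: "\<And>t H. t \<in> T \<Longrightarrow> is_copy n (complete_bipartite t (n - t)) H \<Longrightarrow> has_odd_class r G H"
  shows "n \<le> ell n (T \<union> {n - t | t. t \<in> T} \<union> {n}) + r"
proof -
  let ?W = "T \<union> {n - t | t. t \<in> T} \<union> {n}"
  \<comment> \<open>Index \<open>r\<close> carries the first entry in place of the parity of the
    last colour, so there are still only \<open>r\<close> conditions.\<close>
  define f where "f i v = (if i = r then v 1 else (\<Sum>e\<in>G i. sum v e))" for i and v :: "nat \<Rightarrow> bit"
  have add: "f i (x + y) = f i x + f i y" for i x y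
    by (simp add: f_def sum.distrib)
  define K where "K = {v \<in> F2_space n. \<forall>i\<in>{1..r}. f i v = 0}"
  have "f2.subspace K"
    unfolding K_def by (intro subspace_kernels subspace_F2_space add)
  then have code: "is_linear_code n K" by (auto simp: is_linear_code_def K_def)
  have dim: "n \<le> f2.dim K + r"
    using dim_le_dim_kernels[of "{1..r}" "F2_space n" n f] subspace_F2_space[of n] add
    by (auto simp: K_def dim_F2_space)
  have GE: "G i \<subseteq> edges (complete_graph n)" if "i \<in> {1..r}" for i
    using col that by (auto simp: is_colouring_def)
  have ev: "even (card (cut_edges n v \<inter> G i))" if "v \<in> K" "i \<in> {1..r}" "i \<noteq> r" for v i
  proof -
    have "f i v = 0" using that(1,2) unfolding K_def by blast
    then have "(\<Sum>e\<in>G i. sum v e) = 0" using that(3) by (simp add: f_def)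
    then show ?thesis using sum_cut_eq_card[OF GE[OF that(2)]] by (simp add: of_nat_bit_eq_0_iff)
  qed
  \<comment> \<open>Keeping \<open>A\<close> apart from \<open>v\<close> lets one argument serve
    both the set of \<open>v\<close> and its complement, which has the same cut.\<close>
  have notT: "card A \<notin> T" if A: "A \<subseteq> {1..n}" and v: "v \<in> K"
    and same: "cut_edges n (char_vec A) = cut_edges n v" for A v
  proof
    assume t: "card A \<in> T"
    have "has_odd_class r G ({1..n}, cut_edges n (char_vec A))"
      using odd[OF t is_copy_complete_bipartite_cut[OF A]] .
    then obtain i where i: "i \<in> {1..r}" "odd (card (cut_edges n v \<inter> G i))"
      by (auto simp: has_odd_class_def same)
    \<comment> \<open>Only colour \<open>r\<close> can meet the cut oddly. Then the whole cut is
      odd, against the evenness of \<open>t * (n - t)\<close>.\<close>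
    then have "i = r" using ev[OF v] by blast
    have disj: "disjoint_family_on G {1..r}" and un: "(\<Union>i\<in>{1..r}. G i) = edges (complete_graph n)"
      using col by (auto simp: is_colouring_def)
    have fin: "finite (edges (complete_graph n))" by (simp add: complete_graph_def)
    have "cut_edges n v = (\<Union>j\<in>{1..r}. cut_edges n v \<inter> G j)"
      using un by (auto simp: cut_edges_def)
    then have "card (cut_edges n v) = card (\<Union>j\<in>{1..r}. cut_edges n v \<inter> G j)" by (rule arg_cong)
    also have "\<dots> = (\<Sum>j\<in>{1..r}. card (cut_edges n v \<inter> G j))"
    proof (rule card_UN_disjoint)
      show "\<forall>i\<in>{1..r}. finite (cut_edges n v \<inter> G i)"
        using finite_subset[OF GE fin] by blast
      show "\<forall>i\<in>{1..r}. \<forall>j\<in>{1..r}. i \<noteq> j \<longrightarrow> (cut_edges n v \<inter> G i) \<inter> (cut_edges n v \<inter> G j) = {}"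
        using disj unfolding disjoint_family_on_def by blast
    qed simp
    also have "\<dots> = card (cut_edges n v \<inter> G r) + (\<Sum>j\<in>{1..r} - {r}. card (cut_edges n v \<inter> G j))"
      using r by (intro sum.remove) auto
    finally have "card (cut_edges n v) =
        card (cut_edges n v \<inter> G r) + (\<Sum>j\<in>{1..r} - {r}. card (cut_edges n v \<inter> G j))" .
    moreover have "even (\<Sum>j\<in>{1..r} - {r}. card (cut_edges n v \<inter> G j))"
      by (rule dvd_sum, rule ev[OF v]) auto
    ultimately have "odd (card (cut_edges n v))"
      using i(2) \<open>i = r\<close> by simp
    moreover have "even (card (cut_edges n v))"
      using card_cut_char_vec[OF A] even t same by auto
    ultimately show False by blast
  qed
  have "wt v \<notin> ?W" if v: "v \<in> K" for v
  proof
    assume W: "wt v \<in> ?W"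
    obtain A where A: "A \<subseteq> {1..n}" "v = char_vec A"
      using v F2_spaceE by (auto simp: K_def)
    have "card A \<notin> T" using notT[OF A(1) v] A(2) by simp
    moreover have "n - card A \<notin> T"
      using notT[OF Diff_subset v, of A] cut_edges_char_vec_compl[OF A(1)] A
      by (simp add: card_Diff_subset finite_subset)
    moreover have "n - (n - t) = t" if "t \<in> T" for t
      using T that by (meson atLeastAtMost_iff diff_diff_cancel div_le_dividend le_trans subsetD)
    \<comment> \<open>Only the all-ones vector is left, and its first entry violates condition
      \<open>r\<close>.\<close>
    ultimately have "card A = n" using W by (auto simp: A(2) wt_char_vec)
    then have "A = {1..n}" using A(1) by (intro card_subset_eq) auto
    then have "v 1 = 1" using n A(2) by simp
    moreover have "f r v = 0" using v r unfolding K_def by auto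
    then have "v 1 = 0" by (simp add: f_def)
    ultimately show False by simp
  qed
  then have "f2.dim K \<le> ell n ?W" using code by (intro dim_le_ell) auto
  then show ?thesis using dim by simp
qed

text \<open>\<open>D\<close> consists of the words of \<open>C\<close> and their complements, so
  forbidding both \<open>t\<close> and \<open>n - t\<close> in \<open>C\<close> keeps weight
  \<open>t\<close> out of \<open>D\<close>. The dimension gained by \<open>D\<close> pays for the
  extra colour.\<close>

lemma exists_colouring_from_code:
  assumes T: "T \<subseteq> {1..n div 2}"
    and C: "is_linear_code n C" "\<forall>v\<in>C. wt v \<notin> T \<union> {n - t | t. t \<in> T} \<union> {n}"
  obtains r G where "1 \<le> r" "r + f2.dim C \<le> n" "is_colouring n r G"
    "\<And>t H. t \<in> T \<Longrightarrow> is_copy n (complete_bipartite t (n - t)) H \<Longrightarrow> has_odd_class r G H"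
proof -
  let ?one = "char_vec {1..n}"
  have Cs: "f2.subspace C" "C \<subseteq> F2_space n" using C(1) by (auto simp: is_linear_code_def)
  obtain B where B: "B \<subseteq> C" "f2.independent B" "C \<subseteq> f2.span B" "card B = f2.dim C"
    by (rule f2.basis_exists)
  have span: "f2.span B = C" using B Cs f2.span_minimal by blast
  have finB: "finite B"
    by (rule finite_subset[OF _ finite_F2_space]) (use B(1) Cs(2) in blast)
  have "wt ?one = n" by (simp add: wt_char_vec)
  then have one: "?one \<notin> C" using C(2) by auto
  define D where "D = f2.span (insert ?one B)"
  have DF: "D \<subseteq> F2_space n"
    unfolding D_def using B(1) Cs(2) char_vec_in_F2_space[of "{1..n}" n]
    by (intro f2.span_minimal subspace_F2_space) blast
  have "f2.independent (insert ?one B)"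
    using one B(2) unfolding span[symmetric] by (rule f2.independent_insertI)
  then have "f2.dim D = card (insert ?one B)"
    unfolding D_def by (rule f2.dim_span_eq_card_independent)
  also have "\<dots> = Suc (card B)"
    by (rule card_insert_disjoint[OF finB]) (use B(1) one in blast)
  also note B(4)
  finally have dimD: "f2.dim D = Suc (f2.dim C)" .
  have oneD: "?one \<in> D" unfolding D_def by (rule f2.span_base) simp
  have DT: "card A \<notin> T" if A: "A \<subseteq> {1..n}" "char_vec A \<in> D" for A
  proof
    assume t: "card A \<in> T"
    \<comment> \<open>For \<open>k = 0\<close> the word itself is in \<open>C\<close>, for
      \<open>k = 1\<close> its complement is.\<close>
    obtain k where k: "char_vec A - scale2 k ?one \<in> C"
      using A(2) unfolding D_def f2.span_breakdown_eq span by blast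
    show False
    proof (cases "k = 0")
      case True
      with k have "char_vec A \<in> C" by (simp only: f2.scale_zero_left diff_zero)
      then show False using C(2) t by (auto simp: wt_char_vec)
    next
      case False
      have "char_vec A - scale2 1 ?one = char_vec ({1..n} - A)"
        unfolding f2.scale_one fun_eq_iff using A(1) by (auto simp: fun_diff_def)
      then have "char_vec ({1..n} - A) \<in> C" using k False by simp
      moreover have "wt (char_vec ({1..n} - A)) = n - card A"
        using A(1) by (simp add: wt_char_vec card_Diff_subset finite_subset)
      ultimately show False using C(2) t by auto
    qed
  qed
  have sD: "f2.subspace D" unfolding D_def by (rule f2.subspace_span)
  obtain r G where G: "1 \<le> r" "r + f2.dim D \<le> Suc n" "is_colouring n r G"
    and ev: "\<And>v. v \<in> F2_space n \<Longrightarrow> \<forall>i\<in>{1..r}. even (card (cut_edges n v \<inter> G i)) \<Longrightarrow> v \<in> D"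
    using exists_star_colouring[OF sD DF oneD] by metis
  have "has_odd_class r G H" if t: "t \<in> T" and H: "is_copy n (complete_bipartite t (n - t)) H" for t H
  proof (rule ccontr)
    assume no: "\<not> has_odd_class r G H"
    have "t \<le> n" using T t by (meson atLeastAtMost_iff div_le_dividend le_trans subsetD)
    from is_copy_complete_bipartite_imp[OF this H]
    obtain A where A: "A \<subseteq> {1..n}" "card A = t" "H = ({1..n}, cut_edges n (char_vec A))" by blast
    have "\<forall>i\<in>{1..r}. even (card (cut_edges n (char_vec A) \<inter> G i))"
      using no by (auto simp: has_odd_class_def A(3))
    then have "char_vec A \<in> D" using ev char_vec_in_F2_space A(1) by blast
    then show False using DT A t by blast
  qed
  moreover have "r + f2.dim C \<le> n" using G(2) dimD by simp
  ultimately show thesis using that G by blast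
qed

section \<open>The exact value of the odd-Ramsey number\<close>

theorem theorem1p3:
  fixes n :: nat and T :: "nat set"
  assumes "n \<ge> 1"
    and "T \<subseteq> {1..n div 2}"
    and "\<forall>t\<in>T. even (t * (n - t))"
  shows "int (r_odd n {complete_bipartite t (n - t) | t. t \<in> T}) =
    int n - int (ell n (T \<union> {n - t | t. t \<in> T} \<union> {n}))"
proof -
  let ?W = "T \<union> {n - t | t. t \<in> T} \<union> {n}"
  let ?F = "{complete_bipartite t (n - t) | t. t \<in> T}"
  define Q where "Q r \<longleftrightarrow> 1 \<le> r \<and>
     (\<exists>G. is_colouring n r G \<and> (\<forall>H\<in>?F. \<forall>H'. is_copy n H H' \<longrightarrow> has_odd_class r G H'))" for r
  have lower: "n \<le> ell n ?W + r" if "Q r" for r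
    using that le_ell_plus_colours[OF assms] unfolding Q_def by blast
  \<comment> \<open>For \<open>n \<ge> 1\<close> every \<open>t \<le> n div 2\<close> is below
    \<open>n\<close>, so weight 0 is not forbidden.\<close>
  have "n - t \<noteq> 0" if "t \<in> T" for t
    using that assms(1,2) by fastforce
  then have "0 \<notin> ?W" using assms(1,2) by auto
  then obtain C where C: "is_linear_code n C" "\<forall>v\<in>C. wt v \<notin> ?W" "f2.dim C = ell n ?W"
    by (rule ell_attained)
  obtain r G where r: "1 \<le> r" "r + f2.dim C \<le> n" "is_colouring n r G"
    "\<And>t H. t \<in> T \<Longrightarrow> is_copy n (complete_bipartite t (n - t)) H \<Longrightarrow> has_odd_class r G H"
    using exists_colouring_from_code[OF assms(2) C(1,2)] by metis
  then have Q: "Q r" unfolding Q_def by blast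
  have eq: "r_odd n ?F = (LEAST r. Q r)" unfolding r_odd_def Q_def ..
  have "r_odd n ?F = n - ell n ?W"
    unfolding eq
  proof (rule Least_equality)
    \<comment> \<open>The lower bound, applied to the constructed colouring, fixes its number of
      colours.\<close>
    have "r = n - ell n ?W" using lower[OF Q] r(2) C(3) by simp
    then show "Q (n - ell n ?W)" using Q by simp
  next
    fix r' assume "Q r'"
    then show "n - ell n ?W \<le> r'" using lower by fastforce
  qed
  \<comment> \<open>The bound \<open>r + f2.dim C \<le> n\<close> rules out truncation in the
    subtraction.\<close>
  then show ?thesis using r(2) C(3) by simp
qed

end
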